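(* Let $q$ be a prime power and let $m>1$ be an integer with $\gcd(m,q-1)=1$. Put $n=(q^m-1)/(q-1)$, and let $\{C_h\}_{h=0}^{n}$ denote the weight distribution of the $q$-ary Hamming code $H(m,q)$, i.e. $C_h$ is the number of codewords of Hamming weight $h$ in $H(m,q)$. Then the following formulas hold (each one for $C_h$ whenever $h\le n$): \begin{align*} C_3=&\frac{1}{3!}(q^m-1)(-q+q^m),\\ C_4=&\frac{1}{4!}(q^m-1)(-6q+5q^2+6q^m+q^{2m}-6q^{1+m}),\\ C_5=&\frac{1}{5!}(q^m-1)(-36q+54q^2-26q^3+36q^m+6q^{2m}+q^{3m}-60q^{1+m}+35q^{2+m}-10q^{1+2m}),\\ C_6=&\frac{1}{6!}(q^m-1)(-240q+500q^2-450q^3+154q^4+240q^m+20q^{2m}+10q^{3m}+q^{4m}-520q^{1+m}\\ &+85q^{2(1+m)}+550q^{2+m}-225q^{3+m}-110q^{1+2m}-15q^{1+3m}),\\ C_7=&\frac{1}{7!}(q^m-1)(-1800q+4710q^2-6035q^3+3940q^4-1044q^5+1800q^m-90q^{2m}+85q^{3m}+15q^{4m}\\ &+q^{5m}-4620q^{1+m}+1505q^{2(1+m)}+6755q^{2+m}-5215q^{3+m}+1624q^{4+m}-805q^{1+2m}-735q^{3+2m}\\ &-245q^{1+3m}+175q^{2+3m}-21q^{1+4m}),\\ C_8=&\frac{1}{8!}(q^m-1)(-15120q+47124q^2-77196q^3+72779q^4-37240q^5+8028q^6+15120q^m-3276q^{2m}+840q^{3m}\\ &+175q^{4m}+21q^{5m}+q^{6m}-43848q^{1+m}+17934q^{2(1+m)}-1960q^{3(1+m)}+79632q^{2+m}\\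 &+6769q^{2(2+m)}-87808q^{3+m}+52661q^{4+m}-13132q^{5+m}-3276q^{1+2m}-19236q^{3+2m}\\ &-3080q^{1+3m}+4270q^{2+3m}-476q^{1+4m}+322q^{2+4m}-28q^{1+5m}),\\ C_9=&\frac{1}{9!}(q^m-1)(-141120q+507024q^2-1002736q^3+1221444q^4-910644q^5+382088q^6-69264q^7\\ &+141120q^m-57456q^{2m}+10864q^{3m}+1960q^{4m}+322q^{5m}+28q^{6m}+q^{7m}-449568q^{1+m}\\ &+165396q^{2(1+m)}-67116q^{3(1+m)}+957936q^{2+m}+246624q^{2(2+m)}-1349404q^{3+m}+1175874q^{4+m}\\ &-571116q^{5+m}+118124q^{6+m}+33936q^{1+2m}-332584q^{3+2m}-67284q^{5+2m}-39396q^{1+3m}\\ &+74844q^{2+3m}+22449q^{4+3m}-7812q^{1+4m}+10332q^{2+4m}-4536q^{3+4m}-840q^{1+5m}\\ &+546q^{2+5m}-36q^{1+6m}),\\ C_{10}=&\frac{1}{10!}(q^m-1)(-1451520q+5880384q^2-13550832q^3+20090832q^4-19485852q^5+11984244q^6\\ &-4251240q^7+663696q^8+1451520q^m-893376q^{2m}+174384q^{3m}+21504q^{4m}+4536q^{5m}+546q^{6m}\\ &+36q^{7m}+q^{8m}-4987008q^{1+m}+857520q^{2(1+m)}-1569540q^{3(1+m)}+63273q^{4(1+m)}+12035088q^{2+m}\\ &+5797770q^{2(2+m)}-20393616q^{3+m}+723680q^{2(3+m)}+23050848q^{4+m}-16423398q^{5+m}+6661236q^{6+m}\\ &-1172700q^{7+m}+1341360q^{1+2m}-4686480q^{3+2m}-3264780q^{5+2m}-576240q^{1+3m}+1233960q^{2+3m}\\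 &+1030260q^{4+3m}-269325q^{5+3m}-117012q^{1+4m}+227808q^{2+4m}-196392q^{3+4m}-17430q^{1+5m}\\ &+22260q^{2+5m}-9450q^{3+5m}-1380q^{1+6m}+870q^{2+6m}-45q^{1+7m}). \end{align*}
   Context: The $q$-ary Hamming code $H(m,q)$ is the $[n,\,n-m,\,3]$ linear code over $\mathbb{F}_q$, with $n=(q^m-1)/(q-1)$, having as parity check matrix an $m\times n$ matrix whose columns consist of exactly one nonzero vector from each one-dimensional subspace of $\mathbb{F}_q^m$. It is determined up to monomial equivalence, so its weight distribution is well defined. When $\gcd(m,q-1)=1$ it is equivalent to the cyclic code of length $n$ over $\mathbb{F}_q$ with defining zero $\gamma^{q-1}$, where $\gamma$ is a primitive element of $\mathbb{F}_{q^m}$. *)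

theory Defs
  imports "HOL-Analysis.Analysis" "HOL-Number_Theory.Prime_Powers"
begin

text \<open>
  The field \<open>\<bbbF>\<^sub>q\<close> is a type of sort \<open>{field, finite}\<close> with \<open>q\<close> elements; words of length \<open>n\<close> are
  vectors of type \<open>'a ^ 'n\<close> with \<open>CARD('n) = n\<close>, and \<open>m \<times> n\<close> matrices have type \<open>'a ^ 'n ^ 'm\<close>.
\<close>

definition hamming_weight :: "'a::zero ^ 'n \<Rightarrow> nat" where
  "hamming_weight c = card {i. c $ i \<noteq> 0}"

definition weight_distribution :: "('a::zero ^ 'n) set \<Rightarrow> nat \<Rightarrow> nat" where
  "weight_distribution C h = card {c \<in> C. hamming_weight c = h}"

definition code_of_parity_check :: "'a::field ^ 'n ^ 'm \<Rightarrow> ('a ^ 'n) set" where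
  "code_of_parity_check H = {c. H *v c = 0}"

text \<open>
  Uniqueness is required of the column index, not only of the column vector, so no
  column is repeated.
\<close>

definition hamming_parity_check :: "'a::field ^ 'n ^ 'm \<Rightarrow> bool" where
  "hamming_parity_check H \<longleftrightarrow>
     (\<forall>j. column j H \<noteq> 0) \<and>
     (\<forall>W. vec.subspace W \<and> vec.dim W = 1 \<longrightarrow> (\<exists>!j. column j H \<in> W))"

end

theory Submission
  imports Defs
begin

text \<open>
  Changing one coordinate of a codeword gives a word that is not a codeword. Conversely, the columns
  of the parity check matrix represent every one-dimensional subspace exactly once, so a nonzero
  syndrome is a multiple of exactly one column, and every word outside the code arises in this way
  from exactly one codeword and one change. Counting the words of weight \<open>h\<close> outside the
  code by these changes yields
  \<open>(h + 1) A\<^bsub>h+1\<^esub> + (h (q - 2) + 1) A\<^sub>h + (n - h + 1) (q - 1) A\<^bsub>h-1\<^esub> = (n choose h) (q - 1)\<^sup>h\<close>.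
  Together with \<open>A\<^sub>0 = 1\<close>, \<open>A\<^sub>1 = 0\<close> and \<open>n (q - 1) = q\<^sup>m - 1\<close> this determines
  \<open>h! A\<^sub>h\<close> as a polynomial in \<open>q\<close> and \<open>X = q\<^sup>m\<close>.
\<close>

section \<open>Words of a given support or weight\<close>

lemma card_Compl_finite_type: "card (- A) = CARD('a) - card A" for A :: "'a::finite set"
  unfolding Compl_eq_Diff_UNIV by (rule card_Diff_subset) auto

text \<open>A word with support \<open>S\<close> amounts to a free choice of a nonzero value at each
  index in \<open>S\<close>.\<close>

lemma card_vec_with_support:
  fixes S :: "'n::finite set"
  shows "card {x :: 'a::{zero, finite} ^ 'n. {i. x $ i \<noteq> 0} = S} = (CARD('a) - 1) ^ card S"
proof -
  have "bij_betw (\<lambda>f. \<chi> i. if i \<in> S then f i else (0::'a)) (S \<rightarrow>\<^sub>E - {0})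
      {x. {i. x $ i \<noteq> 0} = S}"
    by (rule bij_betw_byWitness[where f' = "\<lambda>x. restrict (($) x) S"])
      (auto simp: vec_eq_iff fun_eq_iff PiE_iff extensional_def)
  then have "card {x :: 'a ^ 'n. {i. x $ i \<noteq> 0} = S} = card (S \<rightarrow>\<^sub>E - {0::'a})"
    by (simp add: bij_betw_same_card)
  then show ?thesis
    by (simp add: card_PiE card_Compl_finite_type)
qed

lemma card_hamming_sphere:
  "card {x :: 'a::{zero, finite} ^ 'n. hamming_weight x = h} =
    (CARD('n) choose h) * (CARD('a) - 1) ^ h"
proof -
  have "{x :: 'a ^ 'n. hamming_weight x = h} =
      (\<Union>S\<in>{S. card S = h}. {x. {i. x $ i \<noteq> 0} = S})"
    by (auto simp: hamming_weight_def)
  also have "card \<dots> = (\<Sum>S\<in>{S :: 'n set. card S = h}. card {x :: 'a ^ 'n. {i. x $ i \<noteq> 0} = S})"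
    by (rule card_UN_disjoint) auto
  also have "\<dots> = card {S :: 'n set. card S = h} * (CARD('a) - 1) ^ h"
    by (simp add: card_vec_with_support)
  also have "card {S :: 'n set. card S = h} = CARD('n) choose h"
    using n_subsets[of "UNIV :: 'n set" h] by simp
  finally show ?thesis .
qed

section \<open>Changing a single coordinate\<close>

lemma hamming_weight_add_axis:
  fixes c :: "'a::field ^ 'n"
  assumes "d \<noteq> 0"
  shows "hamming_weight (c + axis j d) =
    (if c $ j = 0 then hamming_weight c + 1
     else if c $ j + d = 0 then hamming_weight c - 1 else hamming_weight c)"
proof -
  let ?S = "{i. c $ i \<noteq> 0}"
  \<comment> \<open>If \<open>c $ j = 0\<close>, then \<open>c $ j + d\<close> is the nonzero
    \<open>d\<close>, so a formerly zero coordinate always falls under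
    \<open>insert\<close>.\<close>
  have "{i. (c + axis j d) $ i \<noteq> 0} = (if c $ j + d = 0 then ?S - {j} else insert j ?S)"
    using assms by (auto simp: axis_def)
  then show ?thesis
    using assms by (auto simp: hamming_weight_def insert_absorb card_insert_if)
qed

text \<open>A change erases a nonzero coordinate, replaces it by another nonzero value, or fills a
  zero coordinate. These lower, keep and raise the weight and are collected in \<open>?T1\<close>,
  \<open>?T2\<close> and \<open>?T3\<close>. The three conditions on \<open>w\<close> exclude each
  other, so at most one summand survives.\<close>

lemma card_neighbours_of_weight:
  fixes c :: "'a::{field, finite} ^ 'n"
  defines "w \<equiv> hamming_weight c"
  shows "card {(j, d). d \<noteq> 0 \<and> hamming_weight (c + axis j d) = h} =
    (if w = h + 1 then w else 0) + (if w = h then w * (CARD('a) - 2) else 0)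
    + (if w + 1 = h then (CARD('n) - w) * (CARD('a) - 1) else 0)"
proof -
  let ?S = "{i. c $ i \<noteq> 0}"
  have w: "card ?S = w" by (simp add: w_def hamming_weight_def)
  \<comment> \<open>Positivity turns the truncated \<open>w - 1 = h\<close> into
    \<open>w = h + 1\<close> when a coordinate is erased.\<close>
  have wpos: "w > 0" if "c $ j \<noteq> 0" for j
    using that unfolding w[symmetric] by (auto simp: card_gt_0_iff)
  let ?T1 = "Sigma ?S (\<lambda>j. {- c $ j})"
  let ?T2 = "Sigma ?S (\<lambda>j. - {0, - c $ j})"
  let ?T3 = "Sigma (- ?S) (\<lambda>j. - {0 :: 'a})"
  have T1: "card ?T1 = w" using w by simp
  \<comment> \<open>On the support the two excluded values of \<open>d\<close> are distinct, hence
    the 2.\<close>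
  have "card (- {0, - c $ j}) = CARD('a) - 2" if "j \<in> ?S" for j
    using that by (simp add: card_Compl_finite_type)
  then have T2: "card ?T2 = w * (CARD('a) - 2)" using w by simp
  have T3: "card ?T3 = (CARD('n) - w) * (CARD('a) - 1)" using w by (simp add: card_Compl_finite_type)
  have mem: "(d \<noteq> 0 \<and> hamming_weight (c + axis j d) = h) \<longleftrightarrow>
      (j, d) \<in> (if w = h + 1 then ?T1 else if w = h then ?T2 else if w + 1 = h then ?T3 else {})"
    for j d
  proof (cases "d = 0")
    case False
    then show ?thesis
      using wpos[of j]
      by (cases "c $ j = 0") (auto simp: hamming_weight_add_axis w_def[symmetric] add_eq_0_iff)
  qed simp
  have "{(j, d). d \<noteq> 0 \<and> hamming_weight (c + axis j d) = h} =
      (if w = h + 1 then ?T1 else if w = h then ?T2 else if w + 1 = h then ?T3 else {})"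
    by (intro set_eqI) (simp only: mem split_paired_all mem_Collect_eq case_prod_conv)
  then show ?thesis
    using T1 T2 T3 by simp
qed

section \<open>Syndromes and the recurrence for the weights\<close>

text \<open>The line spanned by \<open>s\<close> contains exactly one column, which fixes
  \<open>j\<close>; that column is nonzero, which fixes the scalar.\<close>

lemma hamming_syndrome_unique:
  fixes H :: "'a::field ^ 'n ^ 'm"
  assumes H: "hamming_parity_check H" and s: "s \<noteq> 0"
  shows "\<exists>!(j, d). d \<noteq> 0 \<and> d *s column j H = s"
proof -
  have "vec.subspace (vec.span {s})" "vec.dim (vec.span {s}) = 1"
    using s by (simp_all add: vec.dim_span vec.dim_eq_card_independent)
  then obtain j where j: "column j H \<in> vec.span {s}"
    and uniq: "\<And>j'. column j' H \<in> vec.span {s} \<Longrightarrow> j' = j"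
    using H unfolding hamming_parity_check_def by metis
  have nz: "column j H \<noteq> 0" for j using H by (simp add: hamming_parity_check_def)
  obtain k where k: "column j H = k *s s" using j by (auto simp: vec.span_singleton)
  have "k \<noteq> 0" using k nz[of j] by auto
  then have "inverse k *s column j H = s" using k by (simp add: vector_smult_assoc)
  show ?thesis
  proof (rule ex1I[of _ "(j, inverse k)"], goal_cases)
    case 1
    show ?case using \<open>inverse k *s column j H = s\<close> \<open>k \<noteq> 0\<close> by simp
  next
    case (2 p)
    obtain j' d where p: "p = (j', d)" by (cases p)
    then have d: "d \<noteq> 0" "d *s column j' H = s" using 2 by auto
    then have "column j' H = inverse d *s s" by (auto simp: vector_smult_assoc)
    then have "j' = j" by (intro uniq) (auto simp: vec.span_singleton)
    moreover have "d = inverse k"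
      using d \<open>inverse k *s column j H = s\<close> nz[of j] \<open>j' = j\<close>
      by (metis vector_mul_rcancel)
    ultimately show ?case by (simp add: p)
  qed
qed

lemma matrix_vector_mult_axis:
  fixes H :: "'a::comm_semiring_1 ^ 'n ^ 'm"
  shows "H *v axis j d = d *s column j H"
  by (simp add: matrix_vector_mult_def axis_def column_def vec_eq_iff if_distrib mult.commute
      cong: if_cong)

text \<open>Words of weight \<open>k + 1\<close> are counted through their codeword neighbours.
  Centring the relation at \<open>k + 1\<close> avoids the predecessor of an index of
  \<open>A\<close>.\<close>

lemma hamming_weight_recurrence:
  fixes H :: "'a::{field, finite} ^ 'n ^ 'm"
  assumes H: "hamming_parity_check H"
  defines "A \<equiv> weight_distribution (code_of_parity_check H)"
  shows "(k + 2) * A (k + 2) + (k + 1) * (CARD('a) - 2) * A (k + 1)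
      + (CARD('n) - k) * (CARD('a) - 1) * A k + A (k + 1)
    = (CARD('n) choose (k + 1)) * (CARD('a) - 1) ^ (k + 1)"
proof -
  let ?C = "code_of_parity_check H"
  let ?h = "k + 1"
  let ?N = "\<lambda>c. {(j, d). d \<noteq> 0 \<and> hamming_weight (c + axis j d) = ?h}"
  let ?B = "{x. H *v x \<noteq> 0 \<and> hamming_weight x = ?h}"
  \<comment> \<open>The syndrome of \<open>c + axis j d\<close> is \<open>d *s column j H\<close>.
    Its unique representation recovers \<open>(j, d)\<close> and then \<open>c\<close>; for
    surjectivity, subtracting the change found from the syndrome gives a codeword.\<close>
  have "bij_betw (\<lambda>(c, j, d). c + axis j d) (Sigma ?C ?N) ?B"
  proof (rule bij_betw_imageI)
    show "inj_on (\<lambda>(c, j, d). c + axis j d) (Sigma ?C ?N)"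
    proof (rule inj_onI, clarsimp)
      fix c j d c' j' d'
      assume *: "c \<in> ?C" "c' \<in> ?C" "d \<noteq> 0" "d' \<noteq> 0" "c + axis j d = c' + axis j' d'"
      have s: "d *s column j H = d' *s column j' H"
        using arg_cong[OF *(5), of "(*v) H"] *(1,2)
        by (simp add: code_of_parity_check_def matrix_vector_right_distrib matrix_vector_mult_axis)
      have nz: "d *s column j H \<noteq> 0"
        using H \<open>d \<noteq> 0\<close> by (simp add: hamming_parity_check_def)
      have "(j, d) = (j', d')"
        using hamming_syndrome_unique[OF H nz] *(3,4) s by (auto simp: Ex1_def)
      then show "c = c' \<and> j = j' \<and> d = d'" using *(5) by simp
    qed
    show "(\<lambda>(c, j, d). c + axis j d) ` Sigma ?C ?N = ?B"
    proof (intro subset_antisym subsetI)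
      fix x assume "x \<in> (\<lambda>(c, j, d). c + axis j d) ` Sigma ?C ?N"
      then show "x \<in> ?B"
        using H by (auto simp: code_of_parity_check_def matrix_vector_right_distrib
            matrix_vector_mult_axis hamming_parity_check_def)
    next
      fix x assume x: "x \<in> ?B"
      then obtain j d where d: "d \<noteq> 0" "d *s column j H = H *v x"
        using hamming_syndrome_unique[OF H, of "H *v x"] by (auto simp: Ex1_def)
      then have "x - axis j d \<in> ?C"
        by (simp add: code_of_parity_check_def matrix_vector_mult_diff_distrib
            matrix_vector_mult_axis)
      then have "(x - axis j d, j, d) \<in> Sigma ?C ?N" using x d by auto
      then show "x \<in> (\<lambda>(c, j, d). c + axis j d) ` Sigma ?C ?N"
        by (rule rev_image_eqI) simp
    qed
  qed
  then have "card ?B = card (Sigma ?C ?N)"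
    by (simp add: bij_betw_same_card)
  also have "\<dots> = (\<Sum>c\<in>?C. card (?N c))" by simp
  also have "\<dots> = (\<Sum>c\<in>?C. (if hamming_weight c = k + 2 then k + 2 else 0)
      + (if hamming_weight c = k + 1 then (k + 1) * (CARD('a) - 2) else 0)
      + (if hamming_weight c = k then (CARD('n) - k) * (CARD('a) - 1) else 0))"
    by (intro sum.cong refl, subst card_neighbours_of_weight) auto
  also have "\<dots> = (k + 2) * A (k + 2) + (k + 1) * (CARD('a) - 2) * A (k + 1)
      + (CARD('n) - k) * (CARD('a) - 1) * A k"
    by (simp add: sum.distrib A_def weight_distribution_def sum.If_cases Int_def)
  finally have B: "card ?B = \<dots>" .
  \<comment> \<open>The codewords of weight \<open>k + 1\<close> are missing from \<open>?B\<close>;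
    they supply the separate summand \<open>A (k + 1)\<close>.\<close>
  have "card {x :: 'a ^ 'n. hamming_weight x = ?h} = card (?B \<union> {c \<in> ?C. hamming_weight c = ?h})"
    by (rule arg_cong[of _ _ card]) (auto simp: code_of_parity_check_def)
  also have "\<dots> = card ?B + A ?h"
    unfolding A_def weight_distribution_def
    by (rule card_Un_disjoint) (auto simp: code_of_parity_check_def)
  finally show ?thesis
    using B by (simp only: card_hamming_sphere)
qed

section \<open>Solving the recurrence as polynomials in \<open>Q\<close> and
  \<open>X\<close>\<close>

text \<open>Scaling by factorials clears all denominators. With \<open>Q\<close> and
  \<open>X\<close> arbitrary reals, each value becomes a polynomial identity, free of codes and of
  powers with exponent \<open>m\<close>.\<close>

locale scaled_weight_recurrence =
  fixes E :: "nat \<Rightarrow> real" and Q X :: real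
  assumes E0: "E 0 = 1" and E1: "E 1 = 0"
    and E_rec: "\<And>k. E (k + 2) = (\<Prod>i<k + 1. X - 1 - real i * (Q - 1))
      - (1 + real (k + 1) * (Q - 2)) * E (k + 1)
      - real (k + 1) * (X - 1 - real k * (Q - 1)) * E k"
begin

text \<open>For \<open>X = q\<^sup>m\<close>, \<open>V k\<close> is \<open>k!\<close> times the number of words of weight
  \<open>k\<close>, and \<open>E k\<close> is \<open>k!\<close> times the number of codewords of that weight.\<close>

definition V :: "nat \<Rightarrow> real" where
  "V k = (\<Prod>i<k. X - 1 - real i * (Q - 1))"

lemma V1: "V 1 = X - 1"
  by (simp add: V_def)

lemma V_numeral:
  "V (numeral v) = V (pred_numeral v) * (X - 1 - real (pred_numeral v) * (Q - 1))"
  by (simp add: V_def numeral_eq_Suc)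

text \<open>Each value refers to the preceding one, so unfolding ends at \<open>V 1\<close> with an
  explicit product of linear factors.\<close>

lemma V_values:
  "V 2 = V 1 * (X - 1 - 1 * (Q - 1))"
  "V 3 = V 2 * (X - 1 - 2 * (Q - 1))"
  "V 4 = V 3 * (X - 1 - 3 * (Q - 1))"
  "V 5 = V 4 * (X - 1 - 4 * (Q - 1))"
  "V 6 = V 5 * (X - 1 - 5 * (Q - 1))"
  "V 7 = V 6 * (X - 1 - 6 * (Q - 1))"
  "V 8 = V 7 * (X - 1 - 7 * (Q - 1))"
  "V 9 = V 8 * (X - 1 - 8 * (Q - 1))"
  by (simp_all add: V_numeral)

text \<open>The product \<open>X - 1\<close> cancels against the contribution of \<open>E 0\<close>.
  For the code this says that no codeword has weight 2.\<close>

lemma E2: "E 2 = 0"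
  using E_rec[of 0] E0 E1 by (simp add: numeral_2_eq_2)

text \<open>Stated for numerals so that instantiating \<open>v\<close> with a binary numeral and
  simplifying yields concrete indices; \<open>num.Bit0 num.One\<close> is 2 and leads to
  \<open>E 4\<close>.\<close>

lemma E_step:
  "E (numeral v + 2) = V (numeral v + 1) - (1 + (numeral v + 1) * (Q - 2)) * E (numeral v + 1)
     - (numeral v + 1) * (X - 1 - numeral v * (Q - 1)) * E (numeral v)"
  using E_rec[of "numeral v"] by (simp add: V_def)

lemma E3: "E 3 = (X - 1) * (
    -Q + X)"
  using E_rec[of 1] E1 E2 by (simp add: numeral_2_eq_2 numeral_3_eq_3 algebra_simps)

lemma E4: "E 4 = (X - 1) * (
    -6 * Q + 5 * Q^2 + 6 * X + X^2 - 6 * Q * X)"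
  \<comment> \<open>Once the two preceding values are inserted, only a polynomial identity in
    \<open>Q\<close> and \<open>X\<close> remains; the later values follow the same pattern.\<close>
  unfolding E_step[of "num.Bit0 num.One", simplified] E3 E2 V_values V1 by algebra

lemma E5: "E 5 = (X - 1) * (
    -36 * Q + 54 * Q^2 - 26 * Q^3 + 36 * X + 6 * X^2 + X^3 - 60 * Q * X + 35 * Q^2 * X
    - 10 * Q * X^2)"
  unfolding E_step[of "num.Bit1 num.One", simplified] E4 E3 V_values V1 by algebra

lemma E6: "E 6 = (X - 1) * (
    -240 * Q + 500 * Q^2 - 450 * Q^3 + 154 * Q^4 + 240 * X + 20 * X^2 + 10 * X^3 + X^4
    - 520 * Q * X + 85 * Q^2 * X^2 + 550 * Q^2 * X - 225 * Q^3 * X - 110 * Q * X^2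
    - 15 * Q * X^3)"
  unfolding E_step[of "num.Bit0 (num.Bit0 num.One)", simplified] E5 E4 V_values V1 by algebra

lemma E7: "E 7 = (X - 1) * (
    -1800 * Q + 4710 * Q^2 - 6035 * Q^3 + 3940 * Q^4 - 1044 * Q^5 + 1800 * X - 90 * X^2
    + 85 * X^3 + 15 * X^4 + X^5 - 4620 * Q * X + 1505 * Q^2 * X^2 + 6755 * Q^2 * X
    - 5215 * Q^3 * X + 1624 * Q^4 * X - 805 * Q * X^2 - 735 * Q^3 * X^2 - 245 * Q * X^3
    + 175 * Q^2 * X^3 - 21 * Q * X^4)"
  unfolding E_step[of "num.Bit1 (num.Bit0 num.One)", simplified] E6 E5 V_values V1 by algebra

lemma E8: "E 8 = (X - 1) * (
    -15120 * Q + 47124 * Q^2 - 77196 * Q^3 + 72779 * Q^4 - 37240 * Q^5 + 8028 * Q^6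
    + 15120 * X - 3276 * X^2 + 840 * X^3 + 175 * X^4 + 21 * X^5 + X^6 - 43848 * Q * X
    + 17934 * Q^2 * X^2 - 1960 * Q^3 * X^3 + 79632 * Q^2 * X + 6769 * Q^4 * X^2
    - 87808 * Q^3 * X + 52661 * Q^4 * X - 13132 * Q^5 * X - 3276 * Q * X^2
    - 19236 * Q^3 * X^2 - 3080 * Q * X^3 + 4270 * Q^2 * X^3 - 476 * Q * X^4
    + 322 * Q^2 * X^4 - 28 * Q * X^5)"
  unfolding E_step[of "num.Bit0 (num.Bit1 num.One)", simplified] E7 E6 V_values V1 by algebra

lemma E9: "E 9 = (X - 1) * (
    -141120 * Q + 507024 * Q^2 - 1002736 * Q^3 + 1221444 * Q^4 - 910644 * Q^5
    + 382088 * Q^6 - 69264 * Q^7 + 141120 * X - 57456 * X^2 + 10864 * X^3 + 1960 * X^4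
    + 322 * X^5 + 28 * X^6 + X^7 - 449568 * Q * X + 165396 * Q^2 * X^2 - 67116 * Q^3 * X^3
    + 957936 * Q^2 * X + 246624 * Q^4 * X^2 - 1349404 * Q^3 * X + 1175874 * Q^4 * X
    - 571116 * Q^5 * X + 118124 * Q^6 * X + 33936 * Q * X^2 - 332584 * Q^3 * X^2
    - 67284 * Q^5 * X^2 - 39396 * Q * X^3 + 74844 * Q^2 * X^3 + 22449 * Q^4 * X^3
    - 7812 * Q * X^4 + 10332 * Q^2 * X^4 - 4536 * Q^3 * X^4 - 840 * Q * X^5
    + 546 * Q^2 * X^5 - 36 * Q * X^6)"
  unfolding E_step[of "num.Bit1 (num.Bit1 num.One)", simplified] E8 E7 V_values V1 by algebra

lemma E10: "E 10 = (X - 1) * (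
    -1451520 * Q + 5880384 * Q^2 - 13550832 * Q^3 + 20090832 * Q^4 - 19485852 * Q^5
    + 11984244 * Q^6 - 4251240 * Q^7 + 663696 * Q^8 + 1451520 * X - 893376 * X^2
    + 174384 * X^3 + 21504 * X^4 + 4536 * X^5 + 546 * X^6 + 36 * X^7 + X^8
    - 4987008 * Q * X + 857520 * Q^2 * X^2 - 1569540 * Q^3 * X^3 + 63273 * Q^4 * X^4
    + 12035088 * Q^2 * X + 5797770 * Q^4 * X^2 - 20393616 * Q^3 * X + 723680 * Q^6 * X^2
    + 23050848 * Q^4 * X - 16423398 * Q^5 * X + 6661236 * Q^6 * X - 1172700 * Q^7 * X
    + 1341360 * Q * X^2 - 4686480 * Q^3 * X^2 - 3264780 * Q^5 * X^2 - 576240 * Q * X^3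
    + 1233960 * Q^2 * X^3 + 1030260 * Q^4 * X^3 - 269325 * Q^5 * X^3 - 117012 * Q * X^4
    + 227808 * Q^2 * X^4 - 196392 * Q^3 * X^4 - 17430 * Q * X^5 + 22260 * Q^2 * X^5
    - 9450 * Q^3 * X^5 - 1380 * Q * X^6 + 870 * Q^2 * X^6 - 45 * Q * X^7)"
  unfolding E_step[of "num.Bit0 (num.Bit0 (num.Bit0 num.One))", simplified] E9 E8 V_values V1 by algebra

end

section \<open>The Hamming code as an instance of the recurrence\<close>

lemma weight_distribution_0:
  fixes H :: "'a::{field, finite} ^ 'n ^ 'm"
  shows "weight_distribution (code_of_parity_check H) 0 = 1"
proof -
  have "{c \<in> code_of_parity_check H. hamming_weight c = 0} = {0}"
    by (auto simp: code_of_parity_check_def hamming_weight_def vec_eq_iff)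
  then show ?thesis by (simp add: weight_distribution_def)
qed

text \<open>A codeword of weight 1 would make a nonzero multiple of a column vanish.\<close>

lemma hamming_weight_distribution_1:
  fixes H :: "'a::{field, finite} ^ 'n ^ 'm"
  assumes "hamming_parity_check H"
  shows "weight_distribution (code_of_parity_check H) 1 = 0"
proof -
  have False if c: "H *v c = 0" "hamming_weight c = 1" for c
  proof -
    obtain j where j: "{i. c $ i \<noteq> 0} = {j}"
      using c(2) by (auto simp: hamming_weight_def card_1_singleton_iff)
    then have "c $ j \<noteq> 0" by blast
    moreover have "c = axis j (c $ j)"
      using j by (auto simp: vec_eq_iff axis_def)
    then have "c $ j *s column j H = 0"
      using c(1) by (metis matrix_vector_mult_axis)
    ultimately show False
      using assms by (simp add: hamming_parity_check_def)
  qed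
  then show ?thesis
    by (auto simp: weight_distribution_def code_of_parity_check_def)
qed

text \<open>One factor \<open>r\<close> goes to each factor \<open>n - i\<close> of the falling
  factorial. For \<open>r = q - 1\<close> and \<open>n * r = X - 1\<close> the product becomes
  \<open>V k\<close>.\<close>

lemma card_hamming_sphere_real:
  "real ((n choose k) * r ^ k) = (\<Prod>i<k. real n * real r - real i * real r) / fact k"
  by (simp add: binomial_gbinomial gbinomial_prod_rev prod.distrib lessThan_atLeast0
      flip: left_diff_distrib)

text \<open>This is the counting recurrence multiplied by \<open>fact (k + 1)\<close>, with the
  natural-number subtractions moved to the reals.\<close>

lemma scaled_weight_recurrence_hamming:
  fixes H :: "'a::{field, finite} ^ 'n ^ 'm" and X :: real
  assumes H: "hamming_parity_check H"
    and X: "real (CARD('n)) * (real (CARD('a)) - 1) = X - 1"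
  shows "scaled_weight_recurrence
    (\<lambda>k. fact k * real (weight_distribution (code_of_parity_check H) k)) (real (CARD('a))) X"
proof
  let ?A = "weight_distribution (code_of_parity_check H)"
  let ?Q = "real (CARD('a))"
  show "fact 0 * real (?A 0) = 1"
    by (simp add: weight_distribution_0)
  show "fact 1 * real (?A 1) = 0"
    using hamming_weight_distribution_1[OF H] by simp
  fix k
  have "card {0, 1 :: 'a} \<le> CARD('a)" by (rule card_mono) auto
  then have q: "CARD('a) \<ge> 2" by simp
  \<comment> \<open>Beyond the length, \<open>CARD('n) - k\<close> truncates to 0 whereas its real
    counterpart is negative; the vanishing weight count makes both products 0.\<close>
  have le: "?A k = 0" if "k > CARD('n)"
  proof -
    have "hamming_weight c \<le> CARD('n)" for c :: "'a ^ 'n"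
      unfolding hamming_weight_def by (rule card_mono) auto
    then have "{c \<in> code_of_parity_check H. hamming_weight c = k} = {}"
      using that by (auto simp: not_less[symmetric])
    then show ?thesis by (simp only: weight_distribution_def card.empty)
  qed
  have "real ((CARD('n) - k) * (CARD('a) - 1) * ?A k) = (X - 1 - real k * (?Q - 1)) * ?A k"
    using q le by (cases "k \<le> CARD('n)") (simp_all add: of_nat_diff left_diff_distrib flip: X)
  moreover have "real ((k + 1) * (CARD('a) - 2) * ?A (k + 1)) = real (k + 1) * (?Q - 2) * ?A (k + 1)"
    using q by (simp only: of_nat_mult of_nat_diff of_nat_numeral)
  moreover have "real ((CARD('n) choose (k + 1)) * (CARD('a) - 1) ^ (k + 1)) =
      (\<Prod>i<k + 1. X - 1 - real i * (?Q - 1)) / fact (k + 1)"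
    using q unfolding card_hamming_sphere_real by (simp add: of_nat_diff flip: X)
  ultimately have "real (k + 2) * ?A (k + 2) + real (k + 1) * (?Q - 2) * ?A (k + 1)
      + (X - 1 - real k * (?Q - 1)) * ?A k + ?A (k + 1)
      = (\<Prod>i<k + 1. X - 1 - real i * (?Q - 1)) / fact (k + 1)"
    using arg_cong[OF hamming_weight_recurrence[OF H, of k], of real]
    by (simp only: of_nat_add of_nat_mult)
  then have "(\<Prod>i<k + 1. X - 1 - real i * (?Q - 1)) =
      fact (k + 1) * (real (k + 2) * ?A (k + 2) + real (k + 1) * (?Q - 2) * ?A (k + 1)
      + (X - 1 - real k * (?Q - 1)) * ?A k + ?A (k + 1))"
    by simp
  then show "fact (k + 2) * real (?A (k + 2)) = (\<Prod>i<k + 1. X - 1 - real i * (?Q - 1))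
      - (1 + real (k + 1) * (?Q - 2)) * (fact (k + 1) * real (?A (k + 1)))
      - real (k + 1) * (X - 1 - real k * (?Q - 1)) * (fact k * real (?A k))"
    by (simp add: algebra_simps)
qed

section \<open>The explicit weight formulas\<close>

theorem corollary2:
  fixes q m n :: nat
    and H :: "'a::{field, finite} ^ 'n ^ 'm"
  assumes "primepow q" and "CARD('a) = q"
    and "m > 1" and "CARD('m) = m"
    and "gcd m (q - 1) = 1"
    and "n = (q ^ m - 1) div (q - 1)" and "CARD('n) = n"
    and "hamming_parity_check H"
  shows "let Q = real q; C = (\<lambda>h. real (weight_distribution (code_of_parity_check H) h)) in
      (3 \<le> n \<longrightarrow> C 3 = 1 / fact 3 * (Q ^ m - 1) * (
         -Q + Q^m)) \<and>
      (4 \<le> n \<longrightarrow> C 4 = 1 / fact 4 * (Q ^ m - 1) * (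
         -6 * Q + 5 * Q^2 + 6 * Q^m + Q^(2 * m) - 6 * Q^(1+m))) \<and>
      (5 \<le> n \<longrightarrow> C 5 = 1 / fact 5 * (Q ^ m - 1) * (
         -36 * Q + 54 * Q^2 - 26 * Q^3 + 36 * Q^m + 6 * Q^(2 * m) + Q^(3 * m) - 60 * Q^(1+m)
         + 35 * Q^(2+m) - 10 * Q^(1+2 * m))) \<and>
      (6 \<le> n \<longrightarrow> C 6 = 1 / fact 6 * (Q ^ m - 1) * (
         -240 * Q + 500 * Q^2 - 450 * Q^3 + 154 * Q^4 + 240 * Q^m + 20 * Q^(2 * m)
         + 10 * Q^(3 * m) + Q^(4 * m) - 520 * Q^(1+m) + 85 * Q^(2 * (1+m)) + 550 * Q^(2+m)
         - 225 * Q^(3+m) - 110 * Q^(1+2 * m) - 15 * Q^(1+3 * m))) \<and>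
      (7 \<le> n \<longrightarrow> C 7 = 1 / fact 7 * (Q ^ m - 1) * (
         -1800 * Q + 4710 * Q^2 - 6035 * Q^3 + 3940 * Q^4 - 1044 * Q^5 + 1800 * Q^m
         - 90 * Q^(2 * m) + 85 * Q^(3 * m) + 15 * Q^(4 * m) + Q^(5 * m) - 4620 * Q^(1+m)
         + 1505 * Q^(2 * (1+m)) + 6755 * Q^(2+m) - 5215 * Q^(3+m) + 1624 * Q^(4+m)
         - 805 * Q^(1+2 * m) - 735 * Q^(3+2 * m) - 245 * Q^(1+3 * m) + 175 * Q^(2+3 * m)
         - 21 * Q^(1+4 * m))) \<and>
      (8 \<le> n \<longrightarrow> C 8 = 1 / fact 8 * (Q ^ m - 1) * (
         -15120 * Q + 47124 * Q^2 - 77196 * Q^3 + 72779 * Q^4 - 37240 * Q^5 + 8028 * Q^6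
         + 15120 * Q^m - 3276 * Q^(2 * m) + 840 * Q^(3 * m) + 175 * Q^(4 * m)
         + 21 * Q^(5 * m) + Q^(6 * m) - 43848 * Q^(1+m) + 17934 * Q^(2 * (1+m))
         - 1960 * Q^(3 * (1+m)) + 79632 * Q^(2+m) + 6769 * Q^(2 * (2+m)) - 87808 * Q^(3+m)
         + 52661 * Q^(4+m) - 13132 * Q^(5+m) - 3276 * Q^(1+2 * m) - 19236 * Q^(3+2 * m)
         - 3080 * Q^(1+3 * m) + 4270 * Q^(2+3 * m) - 476 * Q^(1+4 * m) + 322 * Q^(2+4 * m)
         - 28 * Q^(1+5 * m))) \<and>
      (9 \<le> n \<longrightarrow> C 9 = 1 / fact 9 * (Q ^ m - 1) * (
         -141120 * Q + 507024 * Q^2 - 1002736 * Q^3 + 1221444 * Q^4 - 910644 * Q^5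
         + 382088 * Q^6 - 69264 * Q^7 + 141120 * Q^m - 57456 * Q^(2 * m) + 10864 * Q^(3 * m)
         + 1960 * Q^(4 * m) + 322 * Q^(5 * m) + 28 * Q^(6 * m) + Q^(7 * m) - 449568 * Q^(1+m)
         + 165396 * Q^(2 * (1+m)) - 67116 * Q^(3 * (1+m)) + 957936 * Q^(2+m)
         + 246624 * Q^(2 * (2+m)) - 1349404 * Q^(3+m) + 1175874 * Q^(4+m) - 571116 * Q^(5+m)
         + 118124 * Q^(6+m) + 33936 * Q^(1+2 * m) - 332584 * Q^(3+2 * m)
         - 67284 * Q^(5+2 * m) - 39396 * Q^(1+3 * m) + 74844 * Q^(2+3 * m)
         + 22449 * Q^(4+3 * m) - 7812 * Q^(1+4 * m) + 10332 * Q^(2+4 * m)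
         - 4536 * Q^(3+4 * m) - 840 * Q^(1+5 * m) + 546 * Q^(2+5 * m) - 36 * Q^(1+6 * m))) \<and>
      (10 \<le> n \<longrightarrow> C 10 = 1 / fact 10 * (Q ^ m - 1) * (
         -1451520 * Q + 5880384 * Q^2 - 13550832 * Q^3 + 20090832 * Q^4 - 19485852 * Q^5
         + 11984244 * Q^6 - 4251240 * Q^7 + 663696 * Q^8 + 1451520 * Q^m - 893376 * Q^(2 * m)
         + 174384 * Q^(3 * m) + 21504 * Q^(4 * m) + 4536 * Q^(5 * m) + 546 * Q^(6 * m)
         + 36 * Q^(7 * m) + Q^(8 * m) - 4987008 * Q^(1+m) + 857520 * Q^(2 * (1+m))
         - 1569540 * Q^(3 * (1+m)) + 63273 * Q^(4 * (1+m)) + 12035088 * Q^(2+m)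
         + 5797770 * Q^(2 * (2+m)) - 20393616 * Q^(3+m) + 723680 * Q^(2 * (3+m))
         + 23050848 * Q^(4+m) - 16423398 * Q^(5+m) + 6661236 * Q^(6+m) - 1172700 * Q^(7+m)
         + 1341360 * Q^(1+2 * m) - 4686480 * Q^(3+2 * m) - 3264780 * Q^(5+2 * m)
         - 576240 * Q^(1+3 * m) + 1233960 * Q^(2+3 * m) + 1030260 * Q^(4+3 * m)
         - 269325 * Q^(5+3 * m) - 117012 * Q^(1+4 * m) + 227808 * Q^(2+4 * m)
         - 196392 * Q^(3+4 * m) - 17430 * Q^(1+5 * m) + 22260 * Q^(2+5 * m)
         - 9450 * Q^(3+5 * m) - 1380 * Q^(1+6 * m) + 870 * Q^(2+6 * m) - 45 * Q^(1+7 * m)))"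
proof -
  define Q where "Q = real q"
  define X where "X = Q ^ m"
  define A where "A h = real (weight_distribution (code_of_parity_check H) h)" for h
  have X_pow: "Q ^ (k * m) = X ^ k" for k
    by (simp add: X_def power_mult[symmetric] mult.commute)
  have q: "q \<ge> 2"
    using primepow_gt_Suc_0[OF assms(1)] by simp
  \<comment> \<open>Divisibility makes the \<open>div\<close> in the length exact, which gives
    \<open>n * (q - 1) = q ^ m - 1\<close>.\<close>
  have "(q - 1) dvd (q ^ m - 1)"
    using q power_diff_1_eq[of "int q" m]
    by (simp add: of_nat_diff flip: int_dvd_int_iff)
  then have "n * (q - 1) = q ^ m - 1"
    using assms(6) by simp
  then have "real n * real (q - 1) = real (q ^ m - 1)"
    by (simp only: flip: of_nat_mult)
  then have "real n * (Q - 1) = X - 1"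
    using q by (simp add: Q_def X_def of_nat_diff)
  then interpret scaled_weight_recurrence "\<lambda>k. fact k * A k" Q X
    using scaled_weight_recurrence_hamming[OF assms(8), of X] assms(2,7)
    by (simp add: Q_def A_def[abs_def])
  have C: "A h = 1 / fact h * (X - 1) * P" if "fact h * A h = (X - 1) * P" for h P
    using that by (simp add: field_simps)
  note E_values = E3 E4 E5 E6 E7 E8 E9 E10
  show ?thesis
    unfolding Let_def Q_def[symmetric] A_def[symmetric]
    \<comment> \<open>Splitting exponents such as \<open>2 * (1 + m)\<close> turns every monomial
      into powers of \<open>Q\<close> and \<open>X\<close>. The resulting products are nested to the
      right, so the values are reassociated to match.\<close>
    by (simp only: add_mult_distrib2 power_add X_pow X_def[symmetric] mult_1_right
        power_one_right arith_simps)
      (intro conjI impI C E_values[unfolded mult.assoc])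
qed

end
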